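(* Let $A:\mathbb{F}^d\to\mathbb{F}^d$ be a linear operator, and let $W$ be a subspace of $\mathbb{F}^d$ with $P_W:\mathbb{F}^d\to\mathbb{F}^d$ the orthogonal projection onto $W$. A set of spatial observational vectors $\{b_1,\dots,b_L\}\subset\mathbb{F}^d$ is complete for the source recovery problem (for $A$ and $W$) if and only if there exist vectors $g_1,\dots,g_N\in Z(A;b_1,\dots,b_L)$, for some $N\in\mathbb{N}$, such that (1) there exists a solution $M\in\mathbb{F}^{L\times N}$ of the matrix equation $$BM=(A-I)G,$$ where $B$ is the $d\times L$ matrix having $b_1,\dots,b_L$ as columns and $G$ is the $d\times N$ matrix with columns $g_1,\dots,g_N$; and (2) $\{P_W(g_1),\dots,P_W(g_N)\}$ spans $W$.
   Context: $\mathbb{F}$ is $\mathbb{R}$ or $\mathbb{C}$, and $\langle x,y\rangle=y^*x$ is the canonical inner product on $\mathbb{F}^d$. $Z(A;b_1,\dots,b_L):=\mathrm{span}\{A^n b_\ell: n\in\mathbb{N}_0,\ 1\le\ell\le L\}$. Source recovery problem: given $A$ with adjoint $A^*$, a subspace $W\subseteq\mathbb{F}^d$ and vectors $b_1,\dots,b_L\in\mathbb{F}^d$ (called spatial observational vectors), consider the dynamics $x(n+1)=A^*x(n)+\omega$, $n\in\mathbb{N}_0$, $x(0)=x_0$, where the constant source $\omega\in W$ and the initial state $x_0\in\mathbb{F}^d$ are unknown, with measurements $y_\ell(n)=\langle x(n),b_\ell\rangle$, $1\le\ell\le L$. The set $\{b_1,\dots,b_L\}$ is complete if every $\omega\in W$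 can be recovered, regardless of $x_0$, by finitely many linear operations from finitely many measurements; that is, there exist $T\in\mathbb{N}_0$ and vectors $u_{n,\ell}\in\mathbb{F}^d$ ($0\le n\le T$, $1\le\ell\le L$) such that $\omega=\sum_{n,\ell}y_\ell(n)\,u_{n,\ell}$ for all $x_0\in\mathbb{F}^d$ and all $\omega\in W$. *)

theory Defs
  imports "Jordan_Normal_Form.Schur_Decomposition"
begin

text \<open>Linear operators on $F^d$ are given by their $d \times d$ matrices in the canonical basis.
  The inner product is $v \bullet c\, w = w^* v$, linear in the first argument;
  \<^term>\<open>mat_adjoint A\<close> is the conjugate transpose. Over the reals the conjugation is the identity.\<close>

abbreviation vec_span :: "nat \<Rightarrow> 'a::field vec set \<Rightarrow> 'a vec set" where
  "vec_span d S \<equiv> LinearCombinations.module.span class_ring (module_vec TYPE('a) d) S"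

abbreviation vec_subspace :: "nat \<Rightarrow> 'a::field vec set \<Rightarrow> bool" where
  "vec_subspace d W \<equiv> VectorSpace.subspace class_ring W (module_vec TYPE('a) d)"

text \<open>The description below is meaningful because, over the reals and the complex numbers,
  every vector decomposes uniquely along a subspace and its orthogonal complement.\<close>

definition orth_proj :: "'a::conjugatable_field vec set \<Rightarrow> 'a vec \<Rightarrow> 'a vec" where
  "orth_proj W v = (THE w. w \<in> W \<and> (\<forall>u\<in>W. (v - w) \<bullet>c u = 0))"

definition Z_space :: "nat \<Rightarrow> 'a::field mat \<Rightarrow> 'a vec list \<Rightarrow> 'a vec set" where
  "Z_space d A bs = vec_span d {(A ^\<^sub>m n) *\<^sub>v b | n b. b \<in> set bs}"

primrec source_state ::
  "'a::conjugatable_field mat \<Rightarrow> 'a vec \<Rightarrow> 'a vec \<Rightarrow> nat \<Rightarrow> 'a vec" where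
  "source_state A \<omega> x0 0 = x0"
| "source_state A \<omega> x0 (Suc n) = mat_adjoint A *\<^sub>v source_state A \<omega> x0 n + \<omega>"

definition measurement ::
  "'a::conjugatable_field mat \<Rightarrow> 'a vec list \<Rightarrow> 'a vec \<Rightarrow> 'a vec \<Rightarrow> nat \<Rightarrow> nat \<Rightarrow> 'a" where
  "measurement A bs \<omega> x0 l n = source_state A \<omega> x0 n \<bullet>c (bs ! l)"

text \<open>The coefficient vectors \<open>u n l\<close> must not depend on the initial state or on the source.
  Observational vectors are indexed from 0.\<close>

definition source_complete ::
  "nat \<Rightarrow> 'a::conjugatable_field mat \<Rightarrow> 'a vec set \<Rightarrow> 'a vec list \<Rightarrow> bool" where
  "source_complete d A W bs \<longleftrightarrow>
    (\<exists>T u. (\<forall>n\<le>T. \<forall>l<length bs. u n l \<in> carrier_vec d) \<and>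
      (\<forall>x0\<in>carrier_vec d. \<forall>\<omega>\<in>W.
        \<omega> = finsum_vec TYPE('a) d
              (\<lambda>(n, l). measurement A bs \<omega> x0 l n \<cdot>\<^sub>v u n l) ({..T} \<times> {..<length bs})))"

end

theory Submission
  imports Defs
begin

text \<open>Put $S_k = I + A + \dots + A^{k-1}$. Then $y_l(k) = \langle x_0, A^k b_l\rangle +
  \langle \omega, S_k b_l\rangle$, so a linear combination of measurements with (conjugated)
  coefficients $a_{k,l}$ equals $\langle x_0, h\rangle + \langle\omega, g\rangle$ with
  $h = \sum a_{k,l} A^k b_l$ and $g = \sum a_{k,l} S_k b_l$. Completeness means that every coordinate
  of $\omega \in W$ arises in this way with $h = 0$. Since $(A - I) S_k = A^k - I$, we have
  $(A - I) g = h - \sum_l (\sum_k a_{k,l}) b_l$, and $h = 0$ forces $(A - I) g$ into the span of the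
  $b_l$. Conversely, if $g \in Z$ and $(A - I) g$ is in that span, then $A^k = S_{k+1} - S_k$ expresses
  $g$ through the $S_k b_l$, and $S_0 = 0$ leaves the coefficients $a_{0,l}$ free to achieve $h = 0$.
  Condition (2) says that no nonzero vector of $W$ is orthogonal to all the $g_j$.\<close>

section \<open>Combinations over index sets, subspaces, and column-by-column solvability\<close>

context vec_space
begin

text \<open>Different pairs (k, l) may give the same vector, so coefficients are attached to indices
  and not, as in \<open>lincomb\<close>, to the vectors themselves. The coordinatewise form turns
  every identity between combinations into an identity between finite scalar sums.\<close>

definition indexed_comb :: "('i \<Rightarrow> 'a) \<Rightarrow> ('i \<Rightarrow> 'a vec) \<Rightarrow> 'i set \<Rightarrow> 'a vec" where
  "indexed_comb a f I = vec n (\<lambda>i. \<Sum>p\<in>I. a p * f p $ i)"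

lemma indexed_comb_carrier [simp]: "indexed_comb a f I \<in> carrier_vec n"
  by (simp add: indexed_comb_def)

lemma index_indexed_comb [simp]: "i < n \<Longrightarrow> indexed_comb a f I $ i = (\<Sum>p\<in>I. a p * f p $ i)"
  by (simp add: indexed_comb_def)

lemma subspace_carrier: "vec_subspace n (W :: 'a vec set) \<Longrightarrow> W \<subseteq> carrier_vec n"
  using submodule.subset[of class_ring W V] by (auto simp: VectorSpace.subspace_def)

lemma subspace_zero: "vec_subspace n (W :: 'a vec set) \<Longrightarrow> 0\<^sub>v n \<in> W"
  using submodule.zero_closed[of class_ring W V] by (auto simp: VectorSpace.subspace_def)

lemma subspace_add: "vec_subspace n (W :: 'a vec set) \<Longrightarrow> v \<in> W \<Longrightarrow> w \<in> W \<Longrightarrow> v + w \<in> W"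
  using submodule.m_closed[of class_ring W V] by (auto simp: VectorSpace.subspace_def)

lemma subspace_smult: "vec_subspace n (W :: 'a vec set) \<Longrightarrow> v \<in> W \<Longrightarrow> c \<cdot>\<^sub>v v \<in> W"
  using submodule.smult_closed[of class_ring W V c v] by (auto simp: VectorSpace.subspace_def class_ring_simps)

lemma subspace_diff:
  fixes W :: "'a vec set"
  assumes W: "vec_subspace n W" and v: "v \<in> W" and w: "w \<in> W"
  shows "v - w \<in> W"
proof -
  have "v + (-1) \<cdot>\<^sub>v w \<in> W" using assms by (intro subspace_add subspace_smult)
  moreover have "v + (-1) \<cdot>\<^sub>v w = v - w"
    using subspace_carrier[OF W] v w by (intro eq_vecI) auto
  ultimately show ?thesis by simp
qed

lemma indexed_comb_in_subspace:
  fixes W :: "'a vec set"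
  assumes W: "vec_subspace n W" and f: "\<And>p. p \<in> I \<Longrightarrow> f p \<in> W"
  shows "indexed_comb a f I \<in> W"
  using f
\<comment> \<open>For infinite \<open>I\<close> the coordinate sums default to 0, so this case, like
  the empty one, yields the zero vector.\<close>
proof (induction I rule: infinite_finite_induct)
  case (insert p I)
  have fp: "f p \<in> carrier_vec n" using subspace_carrier[OF W] insert.prems by auto
  have "indexed_comb a f (insert p I) = a p \<cdot>\<^sub>v f p + indexed_comb a f I"
    using fp insert.hyps by (intro eq_vecI) (auto simp: indexed_comb_def)
  then show ?case
    using insert by (auto intro!: subspace_add[OF W] subspace_smult[OF W])
qed (use subspace_zero[OF W] in \<open>auto simp: indexed_comb_def zero_vec_def\<close>)

text \<open>Picking exactly one index for each vector used makes \<open>f\<close> injective on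
  \<open>I\<close>, so that coefficients of vectors can be pulled back to indices without counting
  any vector twice.\<close>

lemma span_image_indexed_comb:
  assumes f: "f ` J \<subseteq> carrier_vec n" and x: "x \<in> span (f ` J)"
  obtains I a where "finite I" "I \<subseteq> J" "x = indexed_comb a f I"
proof -
  from in_spanE[OF x] obtain c A where A: "x = lincomb c A" "finite A" "A \<subseteq> f ` J" by blast
  obtain I where I: "I \<subseteq> J" "inj_on f I" "A = f ` I"
    using A(3) by (meson subset_image_inj)
  have Ac: "A \<subseteq> carrier_vec n" using A(3) f by auto
  have "x = indexed_comb (c \<circ> f) f I"
  proof (rule eq_vecI)
    fix i assume "i < dim_vec (indexed_comb (c \<circ> f) f I)"
    then have i: "i < n" by (simp add: indexed_comb_def)
    show "x $ i = indexed_comb (c \<circ> f) f I $ i"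
      using i I(2) lincomb_index[OF i Ac, of c] by (simp add: A(1) I(3) sum.reindex)
  qed (simp add: A(1) lincomb_dim[OF A(2) Ac] indexed_comb_def)
  moreover have "finite I" using A(2) I(2,3) finite_imageD by blast
  ultimately show thesis using I(1) that by blast
qed

lemma mult_mat_indexed_comb:
  assumes A: "A \<in> carrier_mat n n" and f: "\<And>p. p \<in> I \<Longrightarrow> f p \<in> carrier_vec n"
  shows "A *\<^sub>v indexed_comb a f I = indexed_comb a (\<lambda>p. A *\<^sub>v f p) I"
proof (rule eq_vecI)
  fix i assume "i < dim_vec (indexed_comb a (\<lambda>p. A *\<^sub>v f p) I)"
  then have i: "i < n" by (simp add: indexed_comb_def)
  have "(A *\<^sub>v indexed_comb a f I) $ i = (\<Sum>j<n. \<Sum>p\<in>I. a p * (A $$ (i,j) * f p $ j))"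
    using A i by (auto simp: scalar_prod_def sum_distrib_left lessThan_atLeast0 ac_simps indexed_comb_def
        intro!: sum.cong)
  also have "\<dots> = (\<Sum>p\<in>I. a p * (\<Sum>j<n. A $$ (i,j) * f p $ j))"
    by (subst sum.swap) (simp add: sum_distrib_left)
  also have "\<dots> = (\<Sum>p\<in>I. a p * (A *\<^sub>v f p) $ i)"
  proof (intro sum.cong refl)
    fix p assume "p \<in> I"
    from carrier_vecD[OF f[OF this]]
    show "a p * (\<Sum>j<n. A $$ (i,j) * f p $ j) = a p * (A *\<^sub>v f p) $ i"
      using A i by (simp add: scalar_prod_def lessThan_atLeast0)
  qed
  finally show "(A *\<^sub>v indexed_comb a f I) $ i = indexed_comb a (\<lambda>p. A *\<^sub>v f p) I $ i"
    using i by simp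
qed (use A in \<open>simp add: indexed_comb_def\<close>)

lemma mat_of_cols_mult_indexed_comb:
  assumes "set bs \<subseteq> carrier_vec n" and "c \<in> carrier_vec (length bs)"
  shows "mat_of_cols n bs *\<^sub>v c = indexed_comb (\<lambda>l. c $ l) (\<lambda>l. bs ! l) {..<length bs}"
  using assms
  by (intro eq_vecI) (auto simp: indexed_comb_def scalar_prod_def mat_of_cols_index
      lessThan_atLeast0 ac_simps intro!: sum.cong)

text \<open>Matrix multiplication acts on columns separately: the columns of M solve one linear
  system each, and conversely chosen solutions are assembled into M. This lets condition (1) be
  checked for each g on its own.\<close>

lemma ex_matrix_mult_eq_iff:
  assumes B: "B \<in> carrier_mat n L" and C: "C \<in> carrier_mat n n"
    and gs: "set gs \<subseteq> carrier_vec n"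
  shows "(\<exists>M\<in>carrier_mat L (length gs). B * M = C * mat_of_cols n gs)
    \<longleftrightarrow> (\<forall>g\<in>set gs. \<exists>c\<in>carrier_vec L. B *\<^sub>v c = C *\<^sub>v g)" (is "?L \<longleftrightarrow> ?R")
proof
  let ?G = "mat_of_cols n gs"
  have G: "?G \<in> carrier_mat n (length gs)" by simp
  {
    assume ?L
    then obtain M where M: "M \<in> carrier_mat L (length gs)" "B * M = C * ?G" by blast
    show ?R
    proof
      fix g assume "g \<in> set gs"
      then obtain j where j: "j < length gs" "g = gs ! j" by (auto simp: in_set_conv_nth)
      have "B *\<^sub>v col M j = col (B * M) j" using B M j by (subst col_mult2) auto
      also have "\<dots> = C *\<^sub>v col ?G j" unfolding M(2) using C G j by (subst col_mult2) auto
      also have "col ?G j = g" using j gs by (subst col_mat_of_cols) auto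
      finally show "\<exists>c\<in>carrier_vec L. B *\<^sub>v c = C *\<^sub>v g" using M j by (intro bexI[of _ "col M j"]) auto
    qed
  next
    assume ?R
    then obtain c where c: "\<And>g. g \<in> set gs \<Longrightarrow> c g \<in> carrier_vec L \<and> B *\<^sub>v c g = C *\<^sub>v g"
      by metis
    let ?M = "mat_of_cols L (map c gs)"
    have M: "?M \<in> carrier_mat L (length gs)" by (simp add: mat_of_cols_def)
    have "B * ?M = C * ?G"
    proof (rule mat_col_eqI)
      fix j assume "j < dim_col (C * ?G)"
      then have j: "j < length gs" by simp
      have "col (B * ?M) j = B *\<^sub>v c (gs ! j)"
        using B M j c[of "gs ! j"] by (subst col_mult2) (auto simp: col_mat_of_cols)
      also have "\<dots> = C *\<^sub>v (gs ! j)" using c j by simp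
      also have "\<dots> = col (C * ?G) j"
        using C G j gs by (subst col_mult2[OF C G]) (auto simp: col_mat_of_cols subset_iff)
      finally show "col (B * ?M) j = col (C * ?G) j" .
    qed (use B C in auto)
    then show ?L using M by blast
  }
qed

end

section \<open>The conjugate inner product and orthogonal projections\<close>

context cof_vec_space
begin

lemma cscalar_prod_indexed_comb:
  fixes a :: "'i \<Rightarrow> 'a" and f :: "'i \<Rightarrow> 'a vec"
  assumes f: "\<And>p. p \<in> I \<Longrightarrow> f p \<in> carrier_vec n" and I: "finite I"
  shows "x \<bullet>c indexed_comb a f I = (\<Sum>p\<in>I. (x \<bullet>c f p) * conjugate (a p))"
proof -
  have "x \<bullet>c indexed_comb a f I = (\<Sum>i<n. \<Sum>p\<in>I. x $ i * conjugate (f p $ i) * conjugate (a p))"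
    by (auto simp: scalar_prod_def indexed_comb_def sum_conjugate[OF I] conjugate_dist_mul
        sum_distrib_left lessThan_atLeast0 ac_simps intro!: sum.cong)
  also have "\<dots> = (\<Sum>p\<in>I. (\<Sum>i<n. x $ i * conjugate (f p $ i)) * conjugate (a p))"
    by (subst sum.swap) (simp add: sum_distrib_right)
  also have "\<dots> = (\<Sum>p\<in>I. (x \<bullet>c f p) * conjugate (a p))"
  proof (intro sum.cong refl)
    fix p assume "p \<in> I"
    from carrier_vecD[OF f[OF this]]
    show "(\<Sum>i<n. x $ i * conjugate (f p $ i)) * conjugate (a p) = (x \<bullet>c f p) * conjugate (a p)"
      by (simp add: scalar_prod_def lessThan_atLeast0)
  qed
  finally show ?thesis .
qed

lemma cscalar_prod_commute:
  fixes v w :: "'a vec"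
  assumes "v \<in> carrier_vec n" and "w \<in> carrier_vec n"
  shows "v \<bullet>c w = conjugate (w \<bullet>c v)"
  using assms by (simp add: conjugate_sprod_vec[of _ n] comm_scalar_prod[of _ n])

lemma cscalar_prod_diff_left:
  fixes u v w :: "'a vec"
  assumes "u \<in> carrier_vec n" and "v \<in> carrier_vec n" and "w \<in> carrier_vec n"
  shows "(u - v) \<bullet>c w = u \<bullet>c w - v \<bullet>c w"
  using assms by (simp add: minus_scalar_prod_distrib[of _ n])

lemma mat_adjoint_cscalar_prod:
  fixes A :: "'a mat"
  assumes A: "A \<in> carrier_mat n n" and x: "x \<in> carrier_vec n" and y: "y \<in> carrier_vec n"
  shows "(mat_adjoint A *\<^sub>v x) \<bullet>c y = x \<bullet>c (A *\<^sub>v y)"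
proof -
  have "(mat_adjoint A *\<^sub>v x) \<bullet>c y = (\<Sum>i<n. \<Sum>j<n. conjugate (A $$ (j,i)) * x $ j * conjugate (y $ i))"
    using A x y by (auto simp: mat_adjoint_def mat_of_rows_def scalar_prod_def sum_distrib_right
        lessThan_atLeast0 intro!: sum.cong)
  also have "\<dots> = (\<Sum>j<n. \<Sum>i<n. conjugate (A $$ (j,i)) * x $ j * conjugate (y $ i))"
    by (rule sum.swap)
  also have "\<dots> = x \<bullet>c (A *\<^sub>v y)"
    using A x y by (auto simp: scalar_prod_def sum_conjugate conjugate_dist_mul sum_distrib_left
        lessThan_atLeast0 ac_simps intro!: sum.cong)
  finally show ?thesis .
qed

text \<open>Independent subsets of W have at most n elements, so a maximal one exists. Any further
  vector of W makes it dependent and hence already lies in its span.\<close>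

lemma subspace_eq_span_of_finite:
  fixes W :: "'a vec set"
  assumes W: "vec_subspace n W"
  obtains S where "finite S" "S \<subseteq> W" "\<not> lin_dep S" "span S = W"
proof -
  let ?P = "\<lambda>S. S \<subseteq> W \<and> \<not> lin_dep S"
  have Wc: "W \<subseteq> carrier_vec n" by (rule subspace_carrier[OF W])
  have "\<And>S. ?P S \<Longrightarrow> finite S \<and> card S \<le> n"
    using li_le_dim[OF fin_dim] Wc dim_is_n by auto
  moreover have "?P {}" by (auto simp: lin_dep_def)
  ultimately obtain S where S: "finite S" "maximal S ?P" using maximal_exists[of ?P n "{}"] by blast
  have SW: "S \<subseteq> W" "\<not> lin_dep S" using S(2) by (auto simp: maximal_def)
  have "span S \<subseteq> W" using SW W by (intro span_is_subset) (auto simp: VectorSpace.subspace_def)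
  moreover have "W \<subseteq> span S"
  proof
    fix w assume w: "w \<in> W"
    show "w \<in> span S"
    proof (cases "w \<in> S")
      case True
      then show ?thesis using SW(1) Wc by (meson in_own_span subset_iff subset_trans cV)
    next
      case False
      then have "lin_dep (S \<union> {w})" using S(2) w by (auto simp: maximal_def)
      then show ?thesis using lin_dep_iff_in_span[of S w] SW Wc w False by auto
    qed
  qed
  ultimately show thesis using that S(1) SW by blast
qed

text \<open>Gram-Schmidt turns a basis of W into an orthogonal one, and one more orthogonalisation
  step is applied to v. The correction lies in W, and the remainder is orthogonal to each basis
  vector, hence to all their combinations.\<close>

lemma orth_proj_exists:
  fixes W :: "'a vec set"
  assumes W: "vec_subspace n W" and v: "v \<in> carrier_vec n"
  shows "\<exists>w\<in>W. \<forall>u\<in>W. (v - w) \<bullet>c u = 0"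
proof -
  obtain S where S: "finite S" "S \<subseteq> W" "\<not> lin_dep S" "span S = W"
    by (rule subspace_eq_span_of_finite[OF W])
  obtain ws where ws: "set ws = S" "distinct ws" using finite_distinct_list[OF S(1)] by blast
  have wsc: "set ws \<subseteq> carrier_vec n" using S ws subspace_carrier[OF W] by auto
  define us where "us = gram_schmidt n ws"
  note us = gram_schmidt_result[OF wsc ws(2) _ us_def, unfolded ws(1), OF S(3)]
  \<comment> \<open>\<open>adjuster n v us\<close> is the vector that Gram-Schmidt adds to v, so the
    projection is its negative.\<close>
  define w where "w = (-1) \<cdot>\<^sub>v adjuster n v us"
  have adj: "adjuster n v us \<in> W"
    using adjuster_in_span[OF v us(3) us(5)] us(1) S(4) by auto
  then have adjc: "adjuster n v us \<in> carrier_vec n" using subspace_carrier[OF W] by auto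
  have w: "w \<in> W" unfolding w_def by (intro subspace_smult[OF W] adj)
  have vw: "v - w = adjuster n v us + v" using v adjc unfolding w_def by (intro eq_vecI) auto
  have "(v - w) \<bullet>c u = 0" if u: "u \<in> W" for u
  proof -
    have "u \<in> span (id ` set us)" using u us(1) S(4) by simp
    then obtain I a where I: "finite I" "I \<subseteq> set us" "u = indexed_comb a id I"
      using us(3) by (elim span_image_indexed_comb[rotated]) auto
    have "(v - w) \<bullet>c x = 0" if x: "x \<in> I" for x
    proof -
      obtain i where "i < length us" "x = us ! i" using subsetD[OF I(2) x] by (metis in_set_conv_nth)
      then show ?thesis unfolding vw using adjust_zero[OF us(3) us(2) v] by simp
    qed
    then show ?thesis unfolding I(3) using I us(3)
      by (subst cscalar_prod_indexed_comb) auto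
  qed
  with w show ?thesis by blast
qed

text \<open>Two candidates differ by a vector that lies in W and is orthogonal to W, hence to
  itself, so it is zero. With existence and uniqueness at hand, the definite description in
  \<open>orth_proj\<close> denotes the projection.\<close>

lemma orth_proj:
  fixes W :: "'a vec set"
  assumes W: "vec_subspace n W" and v: "v \<in> carrier_vec n"
  shows "orth_proj W v \<in> W" and "u \<in> W \<Longrightarrow> (v - orth_proj W v) \<bullet>c u = 0"
proof -
  have "\<exists>!w. w \<in> W \<and> (\<forall>u\<in>W. (v - w) \<bullet>c u = 0)"
  proof (rule ex_ex1I)
    show "\<exists>w. w \<in> W \<and> (\<forall>u\<in>W. (v - w) \<bullet>c u = 0)" using orth_proj_exists[OF assms] by blast
  next
    fix w w' assume w: "w \<in> W \<and> (\<forall>u\<in>W. (v - w) \<bullet>c u = 0)" and w': "w' \<in> W \<and> (\<forall>u\<in>W. (v - w') \<bullet>c u = 0)"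
    have c: "w \<in> carrier_vec n" "w' \<in> carrier_vec n" using w w' subspace_carrier[OF W] by auto
    let ?x = "w - w'"
    have xW: "?x \<in> W" using w w' subspace_diff[OF W] by blast
    have "?x = (v - w') - (v - w)" using v c by (intro eq_vecI) auto
    then have "?x \<bullet>c ?x = (v - w') \<bullet>c ?x - (v - w) \<bullet>c ?x"
      using v c cscalar_prod_diff_left[of "v - w'" "v - w" ?x] by simp
    also have "\<dots> = 0" using w w' xW by simp
    finally have "?x = 0\<^sub>v n" using c conjugate_square_eq_0_vec[of ?x n] by simp
    then have "w' + ?x = w'" using c by simp
    moreover have "w' + ?x = w" using c by (intro eq_vecI) auto
    ultimately show "w = w'" by simp
  qed
  from theI'[OF this] show "orth_proj W v \<in> W" and "u \<in> W \<Longrightarrow> (v - orth_proj W v) \<bullet>c u = 0"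
    unfolding orth_proj_def by auto
qed

text \<open>The residual of v is orthogonal to u. This is the bridge between condition (2), which
  speaks of the projected vectors, and the measurements, which see g itself: a source in W cannot
  tell the two apart.\<close>

lemma cscalar_prod_orth_proj:
  fixes W :: "'a vec set"
  assumes W: "vec_subspace n W" and v: "v \<in> carrier_vec n" and u: "u \<in> W"
  shows "u \<bullet>c orth_proj W v = u \<bullet>c v"
proof -
  have c: "u \<in> carrier_vec n" "orth_proj W v \<in> carrier_vec n"
    using orth_proj(1)[OF W v] u subspace_carrier[OF W] by auto
  have "v \<bullet>c u = orth_proj W v \<bullet>c u"
    using orth_proj(2)[OF W v u] v c by (simp add: cscalar_prod_diff_left)
  then show ?thesis using cscalar_prod_commute[OF c] cscalar_prod_commute[OF c(1) v] by simp
qed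

text \<open>The residual of w in W after projection onto \<open>span S\<close> stays in W and is
  orthogonal to S, so \<open>triv\<close> forces it to vanish.\<close>

lemma span_eq_if_orthogonal_trivial:
  fixes W :: "'a vec set"
  assumes W: "vec_subspace n W" and S: "S \<subseteq> W"
    and triv: "\<And>x. x \<in> W \<Longrightarrow> (\<And>s. s \<in> S \<Longrightarrow> x \<bullet>c s = 0) \<Longrightarrow> x = 0\<^sub>v n"
  shows "span S = W"
proof
  have Sc: "S \<subseteq> carrier_vec n" using S subspace_carrier[OF W] by auto
  have U: "vec_subspace n (span S)" using Sc span_is_subspace by simp
  show le: "span S \<subseteq> W" using S W by (intro span_is_subset) (auto simp: VectorSpace.subspace_def)
  show "W \<subseteq> span S"
  proof
    fix w assume w: "w \<in> W"
    then have wc: "w \<in> carrier_vec n" using subspace_carrier[OF W] by auto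
    note p = orth_proj[OF U wc]
    have "w - orth_proj (span S) w = 0\<^sub>v n"
    proof (rule triv)
      show "w - orth_proj (span S) w \<in> W" using p(1) le w subspace_diff[OF W] by blast
      show "(w - orth_proj (span S) w) \<bullet>c s = 0" if "s \<in> S" for s
        using p(2) that in_own_span[OF Sc] by auto
    qed
    moreover have "orth_proj (span S) w \<in> carrier_vec n" using p(1) subspace_carrier[OF U] by auto
    then have "orth_proj (span S) w + (w - orth_proj (span S) w) = w" using wc by (intro eq_vecI) auto
    ultimately have "orth_proj (span S) w = w"
      using \<open>orth_proj (span S) w \<in> carrier_vec n\<close> by simp
    then show "w \<in> span S" using p(1) by simp
  qed
qed


section \<open>The vectors S_k b, written \<open>krylov_sum A b k\<close>, and the measurement
  formula\<close>

primrec krylov_sum :: "'a mat \<Rightarrow> 'a vec \<Rightarrow> nat \<Rightarrow> 'a vec" where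
  "krylov_sum A b 0 = 0\<^sub>v n"
| "krylov_sum A b (Suc k) = krylov_sum A b k + (A ^\<^sub>m k) *\<^sub>v b"

lemma pow_mat_mult_vec_carrier [simp]:
  fixes A :: "'a mat"
  shows "A \<in> carrier_mat n n \<Longrightarrow> b \<in> carrier_vec n \<Longrightarrow> (A ^\<^sub>m k) *\<^sub>v b \<in> carrier_vec n"
  by (rule mult_mat_vec_carrier[of _ n n]) simp_all

lemma krylov_sum_carrier [simp]:
  "A \<in> carrier_mat n n \<Longrightarrow> b \<in> carrier_vec n \<Longrightarrow> krylov_sum A b k \<in> carrier_vec n"
  by (induction k) auto

text \<open>Matrix powers grow by a factor on the right, which gives the second form directly. The
  first needs that A commutes with its powers, obtained by induction with b generalised to A
  b.\<close>

lemma pow_mat_Suc_mult_vec: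
  fixes A :: "'a mat"
  assumes A: "A \<in> carrier_mat n n" and b: "b \<in> carrier_vec n"
  shows "(A ^\<^sub>m Suc k) *\<^sub>v b = A *\<^sub>v ((A ^\<^sub>m k) *\<^sub>v b)"
    and "(A ^\<^sub>m Suc k) *\<^sub>v b = (A ^\<^sub>m k) *\<^sub>v (A *\<^sub>v b)"
proof -
  have right: "(A ^\<^sub>m Suc k) *\<^sub>v b = (A ^\<^sub>m k) *\<^sub>v (A *\<^sub>v b)"
    if "b \<in> carrier_vec n" for k b
    using assoc_mult_mat_vec[of "A ^\<^sub>m k" n n A n b] A that by simp
  show "(A ^\<^sub>m Suc k) *\<^sub>v b = (A ^\<^sub>m k) *\<^sub>v (A *\<^sub>v b)" using b by (rule right)
  show "(A ^\<^sub>m Suc k) *\<^sub>v b = A *\<^sub>v ((A ^\<^sub>m k) *\<^sub>v b)"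
    using b
  proof (induction k arbitrary: b)
    case (Suc k)
    then show ?case
      using right[of b "Suc k"] right[of b k] Suc.IH[of "A *\<^sub>v b"] A by simp
  qed (use A in simp)
qed

text \<open>Here the lowest term b is split off, whereas the recursion splits off the highest one.
  This is the shape that arises when one step of the dynamics replaces b by A b.\<close>

lemma krylov_sum_Suc_shift:
  assumes A: "A \<in> carrier_mat n n" and b: "b \<in> carrier_vec n"
  shows "krylov_sum A b (Suc k) = krylov_sum A (A *\<^sub>v b) k + b"
proof (induction k)
  case 0
  then show ?case using A b by simp
next
  case (Suc k)
  let ?S = "krylov_sum A (A *\<^sub>v b) k" and ?p = "(A ^\<^sub>m k) *\<^sub>v (A *\<^sub>v b)"
  have Ab: "A *\<^sub>v b \<in> carrier_vec n" using A b by simp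
  have c: "?S \<in> carrier_vec n" "?p \<in> carrier_vec n"
    by (rule krylov_sum_carrier[OF A Ab], rule pow_mat_mult_vec_carrier[OF A Ab])
  have "krylov_sum A b (Suc (Suc k)) = krylov_sum A b (Suc k) + (A ^\<^sub>m Suc k) *\<^sub>v b"
    by (rule krylov_sum.simps)
  also have "\<dots> = (?S + b) + ?p"
    by (simp only: Suc pow_mat_Suc_mult_vec(2)[OF A b])
  also have "\<dots> = (?S + ?p) + b"
    using c b by (simp add: assoc_add_vec[of _ n] comm_add_vec[of b n])
  finally show ?case by simp
qed

text \<open>Telescoping: each summand A^j b contributes A^(j+1) b - A^j b.\<close>

lemma minus_one_mult_krylov_sum:
  assumes A: "A \<in> carrier_mat n n" and b: "b \<in> carrier_vec n"
  shows "(A - 1\<^sub>m n) *\<^sub>v krylov_sum A b k = (A ^\<^sub>m k) *\<^sub>v b - b"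
proof (induction k)
  case 0
  have "(A - 1\<^sub>m n) *\<^sub>v 0\<^sub>v n = 0\<^sub>v n" using A by (intro eq_vecI) (auto simp: scalar_prod_def)
  then show ?case using A b by simp
next
  case (Suc k)
  let ?S = "krylov_sum A b k" and ?p = "(A ^\<^sub>m k) *\<^sub>v b" and ?q = "(A ^\<^sub>m Suc k) *\<^sub>v b"
  have A1: "A - 1\<^sub>m n \<in> carrier_mat n n" by (rule minus_carrier_mat) simp
  have cancel: "(p - b) + (q - p) = q - b"
    if "p \<in> carrier_vec n" "q \<in> carrier_vec n" "b \<in> carrier_vec n" for p q b :: "'a vec"
    using that by (intro eq_vecI) auto
  have c: "?S \<in> carrier_vec n" "?p \<in> carrier_vec n" "?q \<in> carrier_vec n"
    by (rule krylov_sum_carrier[OF A b], rule pow_mat_mult_vec_carrier[OF A b],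
        rule pow_mat_mult_vec_carrier[OF A b])
  have "(A - 1\<^sub>m n) *\<^sub>v krylov_sum A b (Suc k) = (A - 1\<^sub>m n) *\<^sub>v ?S + (A - 1\<^sub>m n) *\<^sub>v ?p"
    using mult_add_distrib_mat_vec[OF A1 c(1,2)] by simp
  also have "(A - 1\<^sub>m n) *\<^sub>v ?p = ?q - ?p"
    using minus_mult_distrib_mat_vec[OF A _ c(2), of "1\<^sub>m n"] c(2) pow_mat_Suc_mult_vec(1)[OF A b, of k]
    by (simp del: pow_mat.simps)
  also have "(A - 1\<^sub>m n) *\<^sub>v ?S + (?q - ?p) = (?p - b) + (?q - ?p)" by (simp only: Suc)
  also have "\<dots> = ?q - b"
    using cancel c(2,3) b by blast
  finally show ?case .
qed

lemma mat_adjoint_carrier: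
  fixes A :: "'a mat"
  assumes "A \<in> carrier_mat n n"
  shows "mat_adjoint A \<in> carrier_mat n n"
  using assms by (auto simp: mat_adjoint_def mat_of_rows_def)

lemma source_state_carrier [simp]:
  fixes A :: "'a mat"
  assumes A: "A \<in> carrier_mat n n" and "x0 \<in> carrier_vec n" and "\<omega> \<in> carrier_vec n"
  shows "source_state A \<omega> x0 k \<in> carrier_vec n"
  using assms mult_mat_vec_carrier[OF mat_adjoint_carrier[OF A]] by (induction k) auto

text \<open>Induction on time with b generalised: in the last step of the dynamics the adjoint
  crosses the inner product and turns b into A b, while the added source contributes the inner
  product of \<omega> with b. The shift identity for S_k collects the source terms.\<close>

lemma cscalar_prod_source_state:
  fixes A :: "'a mat"
  assumes A: "A \<in> carrier_mat n n" and x0: "x0 \<in> carrier_vec n" and \<omega>: "\<omega> \<in> carrier_vec n"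
    and b: "b \<in> carrier_vec n"
  shows "source_state A \<omega> x0 k \<bullet>c b = x0 \<bullet>c ((A ^\<^sub>m k) *\<^sub>v b) + \<omega> \<bullet>c krylov_sum A b k"
  using b
proof (induction k arbitrary: b)
  case 0
  then show ?case using A x0 \<omega> by simp
next
  case (Suc k)
  let ?x = "source_state A \<omega> x0 k"
  have Ab: "A *\<^sub>v b \<in> carrier_vec n" using A Suc.prems by simp
  have x: "?x \<in> carrier_vec n" using A x0 \<omega> by simp
  have adj: "mat_adjoint A *\<^sub>v ?x \<in> carrier_vec n"
    using mat_adjoint_carrier[OF A] x by (rule mult_mat_vec_carrier)
  have "source_state A \<omega> x0 (Suc k) \<bullet>c b = (mat_adjoint A *\<^sub>v ?x) \<bullet>c b + \<omega> \<bullet>c b"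
    using adj \<omega> Suc.prems by (simp add: add_scalar_prod_distrib[of _ n])
  also have "\<dots> = x0 \<bullet>c ((A ^\<^sub>m k) *\<^sub>v (A *\<^sub>v b)) + \<omega> \<bullet>c krylov_sum A (A *\<^sub>v b) k + \<omega> \<bullet>c b"
    using mat_adjoint_cscalar_prod[OF A x Suc.prems] Suc.IH[OF Ab] by simp
  also have "\<dots> = x0 \<bullet>c ((A ^\<^sub>m Suc k) *\<^sub>v b) + \<omega> \<bullet>c krylov_sum A b (Suc k)"
    using \<omega> Suc.prems A Ab unfolding krylov_sum_Suc_shift[OF A Suc.prems] pow_mat_Suc_mult_vec(2)[OF A Suc.prems]
    by (simp add: conjugate_add_vec[of _ n] scalar_prod_add_distrib[of _ n])
  finally show ?case .
qed

section \<open>Completeness as a condition on the coefficients of the observations\<close>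

definition krylov_vec :: "'a mat \<Rightarrow> 'a vec list \<Rightarrow> nat \<times> nat \<Rightarrow> 'a vec" where
  "krylov_vec A bs = (\<lambda>(k, l). (A ^\<^sub>m k) *\<^sub>v (bs ! l))"

text \<open>In the measurement at time k with the observational vector of index l, the initial state
  is paired with \<open>krylov_vec A bs (k, l)\<close> and the source with
  \<open>source_vec A bs (k, l)\<close>. Time is the first component of the index.\<close>

definition source_vec :: "'a mat \<Rightarrow> 'a vec list \<Rightarrow> nat \<times> nat \<Rightarrow> 'a vec" where
  "source_vec A bs = (\<lambda>(k, l). krylov_sum A (bs ! l) k)"

context
  fixes A :: "'a mat" and bs :: "'a vec list"
  assumes A: "A \<in> carrier_mat n n" and bs: "set bs \<subseteq> carrier_vec n"
begin

abbreviation observations :: "nat \<Rightarrow> (nat \<times> nat) set" where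
  "observations T \<equiv> {..T} \<times> {..<length bs}"

lemma krylov_vec_carrier: "snd p < length bs \<Longrightarrow> krylov_vec A bs p \<in> carrier_vec n"
  using A bs by (auto simp: krylov_vec_def split_beta intro!: pow_mat_mult_vec_carrier)

lemma source_vec_carrier: "snd p < length bs \<Longrightarrow> source_vec A bs p \<in> carrier_vec n"
  using A bs by (auto simp: source_vec_def split_beta intro!: krylov_sum_carrier)

lemma measurement_eq:
  assumes "x0 \<in> carrier_vec n" and "\<omega> \<in> carrier_vec n" and "l < length bs"
  shows "measurement A bs \<omega> x0 l k = x0 \<bullet>c krylov_vec A bs (k, l) + \<omega> \<bullet>c source_vec A bs (k, l)"
  using assms A bs unfolding measurement_def krylov_vec_def source_vec_def
  by (simp add: cscalar_prod_source_state subset_iff)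

text \<open>Reading the recovery identity one coordinate at a time replaces the vectors u by scalar
  families \<open>a i\<close>. Since the inner product is conjugate linear in its second argument,
  \<open>a i (k, l)\<close> is the conjugate of the i-th coordinate of \<open>u k l\<close>.\<close>

lemma source_complete_iff:
  fixes W :: "'a vec set"
  assumes W: "W \<subseteq> carrier_vec n"
  shows "source_complete n A W bs \<longleftrightarrow> (\<exists>T a. \<forall>x0\<in>carrier_vec n. \<forall>\<omega>\<in>W. \<forall>i<n.
    \<omega> $ i = x0 \<bullet>c indexed_comb (a i) (krylov_vec A bs) (observations T)
           + \<omega> \<bullet>c indexed_comb (a i) (source_vec A bs) (observations T))" (is "_ \<longleftrightarrow> ?R")
proof -
  let ?rec = "\<lambda>T u x0 \<omega>. finsum_vec TYPE('a) n
    (\<lambda>(k, l). measurement A bs \<omega> x0 l k \<cdot>\<^sub>v u k l) (observations T)"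
  \<comment> \<open>Shared by both directions, one of which passes from u to a and the other from a
    to u. The two are linked by conjugation at the observed indices.\<close>
  have rec: "?rec T u x0 \<omega> \<in> carrier_vec n \<and> (\<forall>i<n. ?rec T u x0 \<omega> $ i =
      x0 \<bullet>c indexed_comb (a i) (krylov_vec A bs) (observations T)
      + \<omega> \<bullet>c indexed_comb (a i) (source_vec A bs) (observations T))"
    if u: "\<And>k l. k \<le> T \<Longrightarrow> l < length bs \<Longrightarrow> u k l \<in> carrier_vec n"
      and a: "\<And>k l i. k \<le> T \<Longrightarrow> l < length bs \<Longrightarrow> i < n \<Longrightarrow> conjugate (a i (k, l)) = u k l $ i"
      and x0: "x0 \<in> carrier_vec n" and \<omega>: "\<omega> \<in> W" for T u a x0 \<omega>
  proof -
    have \<omega>c: "\<omega> \<in> carrier_vec n" using W \<omega> by auto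
    have c: "(\<lambda>(k, l). measurement A bs \<omega> x0 l k \<cdot>\<^sub>v u k l) \<in> observations T \<rightarrow> carrier_vec n"
      using u by auto
    have "?rec T u x0 \<omega> $ i =
      x0 \<bullet>c indexed_comb (a i) (krylov_vec A bs) (observations T)
      + \<omega> \<bullet>c indexed_comb (a i) (source_vec A bs) (observations T)" if i: "i < n" for i
    proof -
      have "?rec T u x0 \<omega> $ i = (\<Sum>p\<in>observations T.
          (x0 \<bullet>c krylov_vec A bs p + \<omega> \<bullet>c source_vec A bs p) * conjugate (a i p))"
        using i u a x0 \<omega>c c
        by (subst index_finsum_vec) (auto simp: measurement_eq carrier_vecD[OF u] intro!: sum.cong)
      also have "\<dots> = x0 \<bullet>c indexed_comb (a i) (krylov_vec A bs) (observations T)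
          + \<omega> \<bullet>c indexed_comb (a i) (source_vec A bs) (observations T)"
        by (subst (1 2) cscalar_prod_indexed_comb)
          (auto simp: distrib_right sum.distrib intro!: krylov_vec_carrier source_vec_carrier)
      finally show ?thesis .
    qed
    then show ?thesis using finsum_vec_closed[OF c] by blast
  qed
  show ?thesis
  proof
    assume "source_complete n A W bs"
    then obtain T u where u: "\<And>k l. k \<le> T \<Longrightarrow> l < length bs \<Longrightarrow> u k l \<in> carrier_vec n"
      and eq: "\<And>x0 \<omega>. x0 \<in> carrier_vec n \<Longrightarrow> \<omega> \<in> W \<Longrightarrow> \<omega> = ?rec T u x0 \<omega>"
      unfolding source_complete_def by blast
    show ?R
    proof (intro exI ballI allI impI)
      fix x0 \<omega> :: "'a vec" and i assume *: "x0 \<in> carrier_vec n" "\<omega> \<in> W" "i < n"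
      show "\<omega> $ i = x0 \<bullet>c indexed_comb ((\<lambda>i (k, l). conjugate (u k l $ i)) i) (krylov_vec A bs) (observations T)
        + \<omega> \<bullet>c indexed_comb ((\<lambda>i (k, l). conjugate (u k l $ i)) i) (source_vec A bs) (observations T)"
        using rec[of T u "\<lambda>i (k, l). conjugate (u k l $ i)", OF u _ *(1,2)] eq[OF *(1,2)] *(3) by simp
    qed
  next
    assume ?R
    then obtain T a where eq: "\<And>x0 \<omega> i. x0 \<in> carrier_vec n \<Longrightarrow> \<omega> \<in> W \<Longrightarrow> i < n \<Longrightarrow>
      \<omega> $ i = x0 \<bullet>c indexed_comb (a i) (krylov_vec A bs) (observations T)
           + \<omega> \<bullet>c indexed_comb (a i) (source_vec A bs) (observations T)" by blast
    let ?u = "\<lambda>k l. vec n (\<lambda>i. conjugate (a i (k, l)))"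
    have "\<omega> = ?rec T ?u x0 \<omega>" if "x0 \<in> carrier_vec n" "\<omega> \<in> W" for x0 \<omega>
      using rec[of T ?u a, OF _ _ that] eq[OF that] that W
      by (intro eq_vecI) (auto simp del: finsum_vec)
    then show "source_complete n A W bs"
      unfolding source_complete_def by (intro exI[of _ T] exI[of _ ?u]) auto
  qed
qed

section \<open>The Krylov space Z and its observable vectors\<close>

lemma Z_space_eq: "Z_space n A bs = span (krylov_vec A bs ` (UNIV \<times> {..<length bs}))"
proof -
  have "{(A ^\<^sub>m k) *\<^sub>v b | k b. b \<in> set bs} = krylov_vec A bs ` (UNIV \<times> {..<length bs})"
    by (auto simp: krylov_vec_def image_iff in_set_conv_nth)
  then show ?thesis by (simp add: Z_space_def)
qed

lemma krylov_vecs_carrier: "krylov_vec A bs ` (UNIV \<times> {..<length bs}) \<subseteq> carrier_vec n"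
  using krylov_vec_carrier by auto

lemma subspace_Z_space: "vec_subspace n (Z_space n A bs)"
  unfolding Z_space_eq using krylov_vecs_carrier span_is_subspace by simp

lemma source_vec_in_Z_space:
  assumes l: "l < length bs"
  shows "source_vec A bs (k, l) \<in> Z_space n A bs"
proof (induction k)
  case 0
  then show ?case using subspace_zero[OF subspace_Z_space] by (simp add: source_vec_def)
next
  case (Suc k)
  have "krylov_vec A bs (k, l) \<in> Z_space n A bs"
    unfolding Z_space_eq using in_own_span[of "krylov_vec A bs ` (UNIV \<times> {..<length bs})"] krylov_vecs_carrier l by auto
  then show ?case
    using Suc subspace_add[OF subspace_Z_space] by (simp add: source_vec_def krylov_vec_def)
qed

text \<open>Applied termwise, A - I turns S_k b_l into A^k b_l - b_l. The subtracted b_l does not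
  depend on k, so its coefficients add up over all times.\<close>

lemma minus_one_mult_comb:
  "(A - 1\<^sub>m n) *\<^sub>v indexed_comb a (source_vec A bs) (observations T)
    = indexed_comb a (krylov_vec A bs) (observations T)
      - mat_of_cols n bs *\<^sub>v vec (length bs) (\<lambda>l. \<Sum>k\<le>T. a (k, l))"
proof (rule eq_vecI)
  let ?c = "vec (length bs) (\<lambda>l. \<Sum>k\<le>T. a (k, l))"
  fix i
  assume "i < dim_vec (indexed_comb a (krylov_vec A bs) (observations T) - mat_of_cols n bs *\<^sub>v ?c)"
  then have i: "i < n" by simp
  have A1: "A - 1\<^sub>m n \<in> carrier_mat n n" by (rule minus_carrier_mat) simp
  have S: "(A - 1\<^sub>m n) *\<^sub>v source_vec A bs p = krylov_vec A bs p - bs ! snd p"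
    if "snd p < length bs" for p
    using that minus_one_mult_krylov_sum[OF A, of "bs ! snd p" "fst p"] bs
    by (auto simp: source_vec_def krylov_vec_def split_beta subset_iff)
  have idx: "(krylov_vec A bs p - bs ! snd p) $ i = krylov_vec A bs p $ i - (bs ! snd p) $ i"
    if "snd p < length bs" for p
  proof -
    have "bs ! snd p \<in> carrier_vec n" using bs nth_mem[OF that] by blast
    then show ?thesis using i by simp
  qed
  have "((A - 1\<^sub>m n) *\<^sub>v indexed_comb a (source_vec A bs) (observations T)) $ i
      = (\<Sum>p\<in>observations T. a p * ((A - 1\<^sub>m n) *\<^sub>v source_vec A bs p) $ i)"
    using i source_vec_carrier by (subst mult_mat_indexed_comb[OF A1]) auto
  also have "\<dots> = (\<Sum>p\<in>observations T. a p * krylov_vec A bs p $ i - a p * (bs ! snd p) $ i)"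
  proof (intro sum.cong refl)
    fix p assume "p \<in> observations T"
    then have p: "snd p < length bs" by auto
    show "a p * ((A - 1\<^sub>m n) *\<^sub>v source_vec A bs p) $ i = a p * krylov_vec A bs p $ i - a p * (bs ! snd p) $ i"
      unfolding S[OF p] idx[OF p] by (rule right_diff_distrib)
  qed
  also have "\<dots> = indexed_comb a (krylov_vec A bs) (observations T) $ i
      - (\<Sum>p\<in>observations T. a p * (bs ! snd p) $ i)"
    using i by (simp add: sum_subtractf)
  also have "(\<Sum>p\<in>observations T. a p * (bs ! snd p) $ i)
      = (\<Sum>l<length bs. (\<Sum>k\<le>T. a (k, l)) * (bs ! l) $ i)"
    by (simp add: sum.cartesian_product' sum_distrib_right) (rule sum.swap)
  also have "\<dots> = (mat_of_cols n bs *\<^sub>v ?c) $ i"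
    using i bs by (simp add: mat_of_cols_mult_indexed_comb del: index_mult_mat_vec)
  finally show "((A - 1\<^sub>m n) *\<^sub>v indexed_comb a (source_vec A bs) (observations T)) $ i
      = (indexed_comb a (krylov_vec A bs) (observations T) - mat_of_cols n bs *\<^sub>v ?c) $ i"
    using i by (simp del: index_mult_mat_vec)
qed (use A in simp)

text \<open>One coefficient family serves every horizon from \<open>T0\<close> on, since it vanishes
  at later times. Hence finitely many vectors g can later share a single horizon.\<close>

lemma Z_space_observable:
  assumes g: "g \<in> Z_space n A bs" and c: "c \<in> carrier_vec (length bs)"
    and eq: "mat_of_cols n bs *\<^sub>v c = (A - 1\<^sub>m n) *\<^sub>v g"
  shows "\<exists>a T0. \<forall>T\<ge>T0. indexed_comb a (krylov_vec A bs) (observations T) = 0\<^sub>v n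
    \<and> indexed_comb a (source_vec A bs) (observations T) = g"
proof -
  obtain J \<beta>' where J: "finite J" "J \<subseteq> UNIV \<times> {..<length bs}" "g = indexed_comb \<beta>' (krylov_vec A bs) J"
    using span_image_indexed_comb[OF krylov_vecs_carrier] g unfolding Z_space_eq by metis
  \<comment> \<open>Extension by zero allows the sum over \<open>J\<close> to be replaced by sums
    over full rectangles of indices, and makes the coefficients vanish at all times from
    \<open>T0\<close> on.\<close>
  define \<beta> where "\<beta> p = (if p \<in> J then \<beta>' p else 0)" for p
  obtain T0 where T0: "fst ` J \<subseteq> {..<T0}" using J(1) finite_nat_bounded by blast
  txt \<open>Summation by parts of $g = \sum \beta_{k,l} (S_{k+1} - S_k) b_l$; the value at $k = 0$ is
    irrelevant for $g$ and is chosen so that the coefficients sum to $-c_l$ for every $l$.\<close>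
  define a where "a = (\<lambda>(k, l). case k of 0 \<Rightarrow> - c $ l - \<beta> (0, l) | Suc j \<Rightarrow> \<beta> (j, l) - \<beta> (k, l))"
  have sum_a: "(\<Sum>k\<le>T. a (k, l)) = - c $ l - \<beta> (T, l)" for T l
    by (induction T) (simp_all add: a_def)
  have abel: "(\<Sum>k\<le>T. a (k, l) * s k) = (\<Sum>k<T. \<beta> (k, l) * (s (Suc k) - s k)) - \<beta> (T, l) * s T"
    if "s 0 = 0" for T l and s :: "nat \<Rightarrow> 'a"
    using that by (induction T) (simp_all add: a_def algebra_simps)
  have "indexed_comb a (krylov_vec A bs) (observations T) = 0\<^sub>v n
    \<and> indexed_comb a (source_vec A bs) (observations T) = g" if T: "T0 \<le> T" for T
  proof -
    let ?h = "indexed_comb a (krylov_vec A bs) (observations T)"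
    \<comment> \<open>This removes the boundary terms at time T from both \<open>sum_a\<close> and
      \<open>abel\<close>.\<close>
    have \<beta>T: "\<beta> (T, l) = 0" for l using T0 T by (force simp: \<beta>_def)
    have gc: "g \<in> carrier_vec n" by (simp add: J(3))
    have g': "indexed_comb a (source_vec A bs) (observations T) = g"
    proof (rule eq_vecI)
      fix i assume "i < dim_vec g"
      then have i: "i < n" using gc by simp
      have step: "source_vec A bs (Suc k, l) $ i - source_vec A bs (k, l) $ i = krylov_vec A bs (k, l) $ i"
        if "l < length bs" for k l
        using that i krylov_vec_carrier[of "(k, l)"] source_vec_carrier[of "(k, l)"]
        by (simp add: source_vec_def krylov_vec_def carrier_matD[OF A] del: index_mult_mat_vec)
      have "indexed_comb a (source_vec A bs) (observations T) $ i
          = (\<Sum>l<length bs. \<Sum>k\<le>T. a (k, l) * source_vec A bs (k, l) $ i)"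
        using i by (simp add: sum.cartesian_product') (rule sum.swap)
      also have "\<dots> = (\<Sum>l<length bs. \<Sum>k<T. \<beta> (k, l) * krylov_vec A bs (k, l) $ i)"
      proof (rule sum.cong[OF refl])
        fix l assume "l \<in> {..<length bs}"
        then show "(\<Sum>k\<le>T. a (k, l) * source_vec A bs (k, l) $ i) = (\<Sum>k<T. \<beta> (k, l) * krylov_vec A bs (k, l) $ i)"
          using i abel[of "\<lambda>k. source_vec A bs (k, l) $ i" l T]
          by (simp add: \<beta>T step) (simp add: source_vec_def)
      qed
      also have "\<dots> = (\<Sum>p\<in>{..<T} \<times> {..<length bs}. \<beta> p * krylov_vec A bs p $ i)"
        by (simp add: sum.cartesian_product') (rule sum.swap)
      also have "\<dots> = (\<Sum>p\<in>J. \<beta> p * krylov_vec A bs p $ i)"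
      proof (rule sum.mono_neutral_right)
        show "J \<subseteq> {..<T} \<times> {..<length bs}"
        proof
          fix p assume p: "p \<in> J"
          then have "fst p < T" using T0 T by force
          then show "p \<in> {..<T} \<times> {..<length bs}" using p J(2) by (cases p) auto
        qed
      qed (auto simp: \<beta>_def)
      also have "\<dots> = g $ i" using i by (simp add: J(3) \<beta>_def)
      finally show "indexed_comb a (source_vec A bs) (observations T) $ i = g $ i" .
    qed (simp add: indexed_comb_def J(3))
    have B: "mat_of_cols n bs \<in> carrier_mat n (length bs)" by simp
    have Bc: "mat_of_cols n bs *\<^sub>v c \<in> carrier_vec n" using B c by (rule mult_mat_vec_carrier)
    have "vec (length bs) (\<lambda>l. \<Sum>k\<le>T. a (k, l)) = (-1) \<cdot>\<^sub>v c"
      using c by (intro eq_vecI) (auto simp: sum_a \<beta>T)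
    then have "mat_of_cols n bs *\<^sub>v vec (length bs) (\<lambda>l. \<Sum>k\<le>T. a (k, l)) = (-1) \<cdot>\<^sub>v (mat_of_cols n bs *\<^sub>v c)"
      using mult_mat_vec[OF B c] by simp
    \<comment> \<open>As the coefficients sum to -c, \<open>minus_one_mult_comb\<close> gives (A -
      I) g = h + B c. Since (A - I) g is also B c, this reads B c = h + B c, and h must
      vanish.\<close>
    then have e: "mat_of_cols n bs *\<^sub>v c = ?h - (-1) \<cdot>\<^sub>v (mat_of_cols n bs *\<^sub>v c)"
      using minus_one_mult_comb[of a T] eq g' by simp
    have "h = 0\<^sub>v n" if "y = h - (-1) \<cdot>\<^sub>v y" "y \<in> carrier_vec n" "h \<in> carrier_vec n" for y h :: "'a vec"
    proof (rule eq_vecI)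
      fix i assume "i < dim_vec (0\<^sub>v n :: 'a vec)"
      then have i: "i < n" by simp
      have "y $ i = (h - (-1) \<cdot>\<^sub>v y) $ i" using that(1) by (rule arg_cong)
      then show "h $ i = 0\<^sub>v n $ i" using i that(2,3) by simp
    qed (use that in simp)
    from this[OF e Bc] have "?h = 0\<^sub>v n" by simp
    with g' show ?thesis by blast
  qed
  then show ?thesis by blast
qed

section \<open>The completeness criterion, with the matrix equation taken column by column\<close>

lemma source_complete_iff_solvable:
  fixes W :: "'a vec set"
  assumes W: "vec_subspace n W"
  shows "source_complete n A W bs \<longleftrightarrow> (\<exists>gs. gs \<noteq> [] \<and> set gs \<subseteq> Z_space n A bs
    \<and> (\<forall>g\<in>set gs. \<exists>c\<in>carrier_vec (length bs). mat_of_cols n bs *\<^sub>v c = (A - 1\<^sub>m n) *\<^sub>v g)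
    \<and> span (orth_proj W ` set gs) = W)" (is "_ \<longleftrightarrow> ?R")
proof
  have Wc: "W \<subseteq> carrier_vec n" by (rule subspace_carrier[OF W])
  have B: "mat_of_cols n bs \<in> carrier_mat n (length bs)" by simp
  {
    assume "source_complete n A W bs"
    then obtain T a where eq: "\<And>x0 \<omega> i. x0 \<in> carrier_vec n \<Longrightarrow> \<omega> \<in> W \<Longrightarrow> i < n \<Longrightarrow>
      \<omega> $ i = x0 \<bullet>c indexed_comb (a i) (krylov_vec A bs) (observations T)
           + \<omega> \<bullet>c indexed_comb (a i) (source_vec A bs) (observations T)"
      unfolding source_complete_iff[OF Wc] by blast
    define h where "h i = indexed_comb (a i) (krylov_vec A bs) (observations T)" for i
    define g where "g i = indexed_comb (a i) (source_vec A bs) (observations T)" for i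
    \<comment> \<open>One vector per coordinate of the source. The appended zero vector satisfies
      both conditions trivially and keeps the list nonempty even for n = 0.\<close>
    define gs where "gs = map g [0..<n] @ [0\<^sub>v n]"
    have gc: "g i \<in> carrier_vec n" and hc: "h i \<in> carrier_vec n" for i by (simp_all add: g_def h_def)
    have eq: "\<omega> $ i = x0 \<bullet>c h i + \<omega> \<bullet>c g i"
      if "x0 \<in> carrier_vec n" "\<omega> \<in> W" "i < n" for x0 \<omega> i
      using eq[OF that] by (simp add: g_def h_def)
    have h0: "h i = 0\<^sub>v n" if i: "i < n" for i
    proof -
      \<comment> \<open>The recovery formula is tested on the zero source with initial state
        \<open>h i\<close> itself.\<close>
      have "h i \<bullet>c h i = 0"
        using eq[OF hc[of i] subspace_zero[OF W] i] gc[of i] i by simp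
      then show ?thesis using hc[of i] conjugate_square_eq_0_vec by blast
    qed
    have gs_cases: "x = 0\<^sub>v n \<or> (\<exists>i<n. x = g i)" if "x \<in> set gs" for x
      using that by (auto simp: gs_def)
    have gZ: "g i \<in> Z_space n A bs" for i
      unfolding g_def
      by (rule indexed_comb_in_subspace[OF subspace_Z_space]) (auto intro: source_vec_in_Z_space)
    have "set gs \<subseteq> Z_space n A bs"
      using gs_cases gZ subspace_zero[OF subspace_Z_space] by blast
    moreover have "\<exists>c\<in>carrier_vec (length bs). mat_of_cols n bs *\<^sub>v c = (A - 1\<^sub>m n) *\<^sub>v x"
      if "x \<in> set gs" for x
      using gs_cases[OF that]
    proof (elim disjE exE conjE)
      assume "x = 0\<^sub>v n"
      moreover have "(A - 1\<^sub>m n) *\<^sub>v 0\<^sub>v n = 0\<^sub>v n" using A by (intro eq_vecI) (auto simp: scalar_prod_def)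
      moreover have "mat_of_cols n bs *\<^sub>v 0\<^sub>v (length bs) = 0\<^sub>v n"
        by (intro eq_vecI) (auto simp: scalar_prod_def)
      ultimately show ?thesis by (metis zero_carrier_vec)
    next
      fix i assume i: "i < n" "x = g i"
      \<comment> \<open>As h i = 0, \<open>minus_one_mult_comb\<close> expresses (A - I) g i as -B
        applied to these sums, so the solution sought is the negative of this vector.\<close>
      let ?c = "vec (length bs) (\<lambda>l. \<Sum>k\<le>T. a i (k, l))"
      have c: "?c \<in> carrier_vec (length bs)" by simp
      have "(A - 1\<^sub>m n) *\<^sub>v g i = 0\<^sub>v n - mat_of_cols n bs *\<^sub>v ?c"
        using minus_one_mult_comb[of "a i" T] h0[OF i(1)] by (simp add: g_def h_def)
      also have "\<dots> = mat_of_cols n bs *\<^sub>v ((-1) \<cdot>\<^sub>v ?c)"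
        unfolding mult_mat_vec[OF B c] using mult_mat_vec_carrier[OF B c]
        by (intro eq_vecI) (auto simp del: index_mult_mat_vec)
      finally show ?thesis unfolding i(2) using c by (metis smult_carrier_vec)
    qed
    moreover have "span (orth_proj W ` set gs) = W"
    proof (rule span_eq_if_orthogonal_trivial[OF W])
      have "orth_proj W x \<in> W" if "x \<in> set gs" for x
        using gs_cases[OF that] gc by (intro orth_proj(1)[OF W]) auto
      then show "orth_proj W ` set gs \<subseteq> W" by blast
    next
      fix x assume x: "x \<in> W" and orth: "\<And>s. s \<in> orth_proj W ` set gs \<Longrightarrow> x \<bullet>c s = 0"
      have xc: "x \<in> carrier_vec n" using x Wc by auto
      \<comment> \<open>Taking x as the source and 0 as the initial state, the recovery formula
        reduces x_i to the inner product of x with g i. Because x lies in W, g i may be replaced by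
        its projection, to which x is orthogonal.\<close>
      have "x $ i = 0" if i: "i < n" for i
      proof -
        have "x \<bullet>c g i = x \<bullet>c orth_proj W (g i)"
          using cscalar_prod_orth_proj[OF W gc x] by simp
        also have "\<dots> = 0" using i by (intro orth) (simp add: gs_def)
        finally show ?thesis using eq[OF zero_carrier_vec x i] hc[of i] by simp
      qed
      then show "x = 0\<^sub>v n" using xc by (intro eq_vecI) auto
    qed
    moreover have "gs \<noteq> []" by (simp add: gs_def)
    ultimately show ?R by blast
  next
    assume ?R
    then obtain gs where gsZ: "set gs \<subseteq> Z_space n A bs"
      and sol: "\<And>g. g \<in> set gs \<Longrightarrow> \<exists>c\<in>carrier_vec (length bs). mat_of_cols n bs *\<^sub>v c = (A - 1\<^sub>m n) *\<^sub>v g"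
      and sp: "span (orth_proj W ` set gs) = W" by blast
    have gc: "g \<in> carrier_vec n" if "g \<in> set gs" for g
      using that gsZ subspace_carrier[OF subspace_Z_space] by blast
    have "\<forall>g\<in>set gs. \<exists>a T0. \<forall>T\<ge>T0. indexed_comb a (krylov_vec A bs) (observations T) = 0\<^sub>v n
      \<and> indexed_comb a (source_vec A bs) (observations T) = g"
      using gsZ sol Z_space_observable by blast
    then obtain a T0 where aT0: "\<And>g T. g \<in> set gs \<Longrightarrow> T0 g \<le> T \<Longrightarrow>
        indexed_comb (a g) (krylov_vec A bs) (observations T) = 0\<^sub>v n
        \<and> indexed_comb (a g) (source_vec A bs) (observations T) = g"
      by metis
    \<comment> \<open>A common horizon, beyond all the individual thresholds.\<close>
    define T where "T = Max (T0 ` set gs)"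
    have h: "indexed_comb (a g) (krylov_vec A bs) (observations T) = 0\<^sub>v n"
      and g: "indexed_comb (a g) (source_vec A bs) (observations T) = g" if "g \<in> set gs" for g
      using aT0[OF that, of T] that by (auto simp: T_def)
    have Pc: "orth_proj W ` set gs \<subseteq> carrier_vec n"
      using orth_proj(1)[OF W gc] Wc by blast
    \<comment> \<open>For \<omega> in W the coordinate \<omega>_i is its inner product with e_i,
      hence with the projection of e_i. Condition (2) writes that projection as a combination of
      projected g's, and pairing with \<omega> then allows the projections to be dropped
      again.\<close>
    have "\<exists>c I. finite I \<and> I \<subseteq> set gs \<and> orth_proj W (unit_vec n i) = indexed_comb c (orth_proj W) I"
      if "i < n" for i
      using orth_proj(1)[OF W unit_vec_carrier, of i] span_image_indexed_comb[OF Pc] unfolding sp by metis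
    then obtain c I where I: "\<And>i. i < n \<Longrightarrow> finite (I i)" "\<And>i. i < n \<Longrightarrow> I i \<subseteq> set gs"
      and cI: "\<And>i. i < n \<Longrightarrow> orth_proj W (unit_vec n i) = indexed_comb (c i) (orth_proj W) (I i)"
      by metis
    \<comment> \<open>The weights of the g's composed with the observation coefficients of each g.
      By exchange of summation, \<open>b i\<close> observes the corresponding combination of the g's
      and still cancels the initial state.\<close>
    define b where "b i p = (\<Sum>g\<in>I i. c i g * a g p)" for i p
    have b_comb: "indexed_comb (b i) f (observations T)
        = indexed_comb (c i) (\<lambda>g. indexed_comb (a g) f (observations T)) (I i)" if "i < n" for i f
    proof (rule eq_vecI)
      fix j assume "j < dim_vec (indexed_comb (c i) (\<lambda>g. indexed_comb (a g) f (observations T)) (I i))"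
      then have j: "j < n" by (simp add: indexed_comb_def)
      have "indexed_comb (b i) f (observations T) $ j
          = (\<Sum>p\<in>observations T. \<Sum>g\<in>I i. c i g * (a g p * f p $ j))"
        using j by (simp add: b_def sum_distrib_right mult.assoc)
      also have "\<dots> = (\<Sum>g\<in>I i. \<Sum>p\<in>observations T. c i g * (a g p * f p $ j))" by (rule sum.swap)
      finally show "indexed_comb (b i) f (observations T) $ j
          = indexed_comb (c i) (\<lambda>g. indexed_comb (a g) f (observations T)) (I i) $ j"
        using j by (simp add: sum_distrib_left)
    qed (simp add: indexed_comb_def)
    have hb: "indexed_comb (b i) (krylov_vec A bs) (observations T) = 0\<^sub>v n" if i: "i < n" for i
    proof -
      have "indexed_comb (c i) (\<lambda>g. indexed_comb (a g) (krylov_vec A bs) (observations T)) (I i)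
          = indexed_comb (c i) (\<lambda>_. 0\<^sub>v n) (I i)"
        unfolding indexed_comb_def[of "c i"] using h[OF subsetD[OF I(2)[OF i]]]
        by (intro eq_vecI) (auto simp del: index_indexed_comb)
      then show ?thesis unfolding b_comb[OF i] by (auto simp: indexed_comb_def)
    qed
    have gb: "indexed_comb (b i) (source_vec A bs) (observations T) = indexed_comb (c i) id (I i)"
      if i: "i < n" for i
      unfolding b_comb[OF i] unfolding indexed_comb_def[of "c i"]
      using g[OF subsetD[OF I(2)[OF i]]]
      by (intro eq_vecI) (auto simp del: index_indexed_comb)
    have "\<omega> $ i = x0 \<bullet>c indexed_comb (b i) (krylov_vec A bs) (observations T)
           + \<omega> \<bullet>c indexed_comb (b i) (source_vec A bs) (observations T)"
      if x0: "x0 \<in> carrier_vec n" and \<omega>: "\<omega> \<in> W" and i: "i < n" for x0 \<omega> i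
    proof -
      have \<omega>c: "\<omega> \<in> carrier_vec n" using \<omega> Wc by auto
      have "\<omega> $ i = \<omega> \<bullet>c unit_vec n i"
      proof -
        \<comment> \<open>In the abstract field this follows by evaluating the conjugate of
          \<open>conjugate 1 * 1\<close> in two ways, using that conjugation is multiplicative and
          involutive.\<close>
        have one: "conjugate 1 = (1 :: 'a)"
        proof -
          have "conjugate (conjugate 1 * 1) = conjugate (conjugate 1 :: 'a) * conjugate 1"
            by (rule conjugate_dist_mul)
          then show ?thesis by simp
        qed
        have "conjugate (unit_vec n i) = (unit_vec n i :: 'a vec)"
          using one by (intro eq_vecI) (auto simp: unit_vec_def)
        then show ?thesis using \<omega>c i by simp
      qed
      also have "\<dots> = \<omega> \<bullet>c indexed_comb (c i) (orth_proj W) (I i)"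
        using cscalar_prod_orth_proj[OF W unit_vec_carrier \<omega>, of i] unfolding cI[OF i] by (rule sym)
      also have "\<dots> = (\<Sum>g\<in>I i. (\<omega> \<bullet>c orth_proj W g) * conjugate (c i g))"
        using I[OF i] Pc by (intro cscalar_prod_indexed_comb) auto
      also have "\<dots> = (\<Sum>g\<in>I i. (\<omega> \<bullet>c id g) * conjugate (c i g))"
        using I(2)[OF i] cscalar_prod_orth_proj[OF W gc \<omega>] by (intro sum.cong) auto
      also have "\<dots> = \<omega> \<bullet>c indexed_comb (c i) id (I i)"
        using I[OF i] gc by (intro cscalar_prod_indexed_comb[symmetric]) auto
      finally show ?thesis using x0 by (simp add: hb[OF i] gb[OF i])
    qed
    then show "source_complete n A W bs" unfolding source_complete_iff[OF Wc] by blast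
  }
qed

end

end

text \<open>Working over an arbitrary conjugatable ordered field treats the real and the complex
  case at once. It remains to reassemble the column systems into one matrix equation and to read a
  nonempty list as N \<ge> 1 vectors.\<close>

lemma source_complete_iff_matrix:
  fixes A :: "'a::conjugatable_ordered_field mat"
  assumes A: "A \<in> carrier_mat d d" and W: "vec_subspace d W" and bs: "set bs \<subseteq> carrier_vec d"
    and L: "length bs = L"
  shows "source_complete d A W bs \<longleftrightarrow>
    (\<exists>N\<ge>1. \<exists>gs. length gs = N \<and> set gs \<subseteq> Z_space d A bs \<and>
      (\<exists>M\<in>carrier_mat L N. mat_of_cols d bs * M = (A - 1\<^sub>m d) * mat_of_cols d gs) \<and>
      vec_span d (orth_proj W ` set gs) = W)"
proof -
  interpret cof_vec_space d "TYPE('a)" .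
  have B: "mat_of_cols d bs \<in> carrier_mat d L" using mat_of_cols_carrier(1)[of d bs] L by simp
  have A1: "A - 1\<^sub>m d \<in> carrier_mat d d" by (rule minus_carrier_mat) simp
  have "(\<exists>M\<in>carrier_mat L (length gs). mat_of_cols d bs * M = (A - 1\<^sub>m d) * mat_of_cols d gs)
      \<longleftrightarrow> (\<forall>g\<in>set gs. \<exists>c\<in>carrier_vec L. mat_of_cols d bs *\<^sub>v c = (A - 1\<^sub>m d) *\<^sub>v g)"
    if "set gs \<subseteq> Z_space d A bs" for gs
    using that subspace_carrier[OF subspace_Z_space[OF A bs]] by (intro ex_matrix_mult_eq_iff[OF B A1]) auto
  then have sol: "set gs \<subseteq> Z_space d A bs \<and>
      (\<exists>M\<in>carrier_mat L (length gs). mat_of_cols d bs * M = (A - 1\<^sub>m d) * mat_of_cols d gs) \<and> P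
      \<longleftrightarrow> set gs \<subseteq> Z_space d A bs \<and>
      (\<forall>g\<in>set gs. \<exists>c\<in>carrier_vec L. mat_of_cols d bs *\<^sub>v c = (A - 1\<^sub>m d) *\<^sub>v g) \<and> P" for gs P
    by blast
  have len: "(\<exists>N\<ge>1. \<exists>gs. length gs = N \<and> Q N gs) \<longleftrightarrow> (\<exists>gs. gs \<noteq> [] \<and> Q (length gs) gs)"
    for Q :: "nat \<Rightarrow> 'a vec list \<Rightarrow> bool"
    by (auto simp: Suc_le_eq)
  show ?thesis unfolding source_complete_iff_solvable[OF A bs W] L len sol by (rule refl)
qed

theorem theorem2p4:
  fixes d L :: nat
  shows "(\<forall>(A :: real mat) W bs.
      A \<in> carrier_mat d d \<longrightarrow> vec_subspace d W \<longrightarrow> set bs \<subseteq> carrier_vec d \<longrightarrow> length bs = L \<longrightarrow>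
      (source_complete d A W bs \<longleftrightarrow>
        (\<exists>N\<ge>1. \<exists>gs. length gs = N \<and> set gs \<subseteq> Z_space d A bs \<and>
          (\<exists>M\<in>carrier_mat L N. mat_of_cols d bs * M = (A - 1\<^sub>m d) * mat_of_cols d gs) \<and>
          vec_span d (orth_proj W ` set gs) = W)))
    \<and>
    (\<forall>(A :: complex mat) W bs.
      A \<in> carrier_mat d d \<longrightarrow> vec_subspace d W \<longrightarrow> set bs \<subseteq> carrier_vec d \<longrightarrow> length bs = L \<longrightarrow>
      (source_complete d A W bs \<longleftrightarrow>
        (\<exists>N\<ge>1. \<exists>gs. length gs = N \<and> set gs \<subseteq> Z_space d A bs \<and>
          (\<exists>M\<in>carrier_mat L N. mat_of_cols d bs * M = (A - 1\<^sub>m d) * mat_of_cols d gs) \<and>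
          vec_span d (orth_proj W ` set gs) = W)))"
  by (intro conjI allI impI; rule source_complete_iff_matrix; assumption)

end
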